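(* Let $\mathcal{H},\mathcal{K}$ be complex Hilbert spaces, let $A\in\mathbb{B}(\mathcal{H})$ be a positive operator satisfying $0<m\mathbf{1}_{\mathcal{H}}\le A\le M\mathbf{1}_{\mathcal{H}}$ for some scalars $m,M$ with $m<M$, and let $\Phi:\mathbb{B}(\mathcal{H})\to\mathbb{B}(\mathcal{K})$ be a normalized positive linear map. Then $$\Phi\left(A^{-1}\right)\le \Phi\left(m^{\frac{A-M\mathbf{1}_{\mathcal{H}}}{M-m}}M^{\frac{m\mathbf{1}_{\mathcal{H}}-A}{M-m}}\right)\le \frac{(M+m)^2}{4Mm}\,\Phi(A)^{-1}.$$
   Context: $\mathbb{B}(\mathcal{H})$ denotes the bounded linear operators on the complex Hilbert space $\mathcal{H}$, with identity $\mathbf{1}_{\mathcal{H}}$. An operator $A$ is positive ($0\le A$) if $\langle Ax,x\rangle\ge 0$ for all $x\in\mathcal{H}$; $0<A$ means $A$ is positive and invertible; for self-adjoint $A,B$, $A\le B$ means $0\le B-A$. A linear map $\Phi:\mathbb{B}(\mathcal{H})\to\mathbb{B}(\mathcal{K})$ is positive if $\Phi(A)\ge 0$ whenever $A\ge 0$, and normalized if $\Phi(\mathbf{1}_{\mathcal{H}})=\mathbf{1}_{\mathcal{K}}$. Functions of self-adjoint operators are defined by the continuous functional calculus; in particular $m^{\frac{A-M\mathbf{1}_{\mathcal{H}}}{M-m}}M^{\frac{m\mathbf{1}_{\mathcal{H}}-A}{M-m}}$ is $g(A)$ with $g(t)=m^{\frac{t-M}{M-m}}M^{\frac{m-t}{M-m}}$,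 $t\in[m,M]$. $\Phi(A)^{-1}$ means $(\Phi(A))^{-1}$. *)

theory Defs
  imports "HOL-Analysis.Analysis"
begin

section \<open>Complex Hilbert spaces\<close>

class complex_vector = real_vector +
  fixes scaleC :: "complex \<Rightarrow> 'a \<Rightarrow> 'a"  (infixr \<open>*\<^sub>C\<close> 75)
  assumes scaleC_add_right: "c *\<^sub>C (x + y) = c *\<^sub>C x + c *\<^sub>C y"
    and scaleC_add_left: "(c + d) *\<^sub>C x = c *\<^sub>C x + d *\<^sub>C x"
    and scaleC_scaleC: "c *\<^sub>C d *\<^sub>C x = (c * d) *\<^sub>C x"
    and scaleR_scaleC: "r *\<^sub>R x = complex_of_real r *\<^sub>C x"

lemma scaleC_one: "1 *\<^sub>C (x :: 'a::complex_vector) = x"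
  using scaleR_scaleC[of 1 x] by simp

interpretation complex_vector: vector_space "scaleC :: complex \<Rightarrow> 'a \<Rightarrow> 'a::complex_vector"
  by unfold_locales (simp_all add: scaleC_add_right scaleC_add_left scaleC_scaleC scaleC_one)

text \<open>
  The inner product is linear in the first argument. The last axiom says at once that
  \<open>cinner x x\<close> is real and nonnegative, that it vanishes only for \<open>x = 0\<close>, and that the norm
  is the one induced by the inner product.
\<close>

class complex_inner = complex_vector + real_normed_vector +
  fixes cinner :: "'a \<Rightarrow> 'a \<Rightarrow> complex"
  assumes cinner_add_left: "cinner (x + y) z = cinner x z + cinner y z"
    and cinner_scaleC_left: "cinner (c *\<^sub>C x) y = c * cinner x y"
    and cinner_commute: "cinner x y = cnj (cinner y x)"
    and cinner_self: "cinner x x = complex_of_real ((norm x)\<^sup>2)"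

class complex_hilbert = complex_inner + complete_space

instantiation complex :: complex_hilbert
begin
definition scaleC_complex :: "complex \<Rightarrow> complex \<Rightarrow> complex" where
  "scaleC_complex c x = c * x"
definition cinner_complex :: "complex \<Rightarrow> complex \<Rightarrow> complex" where
  "cinner_complex x y = x * cnj y"
instance
proof
  fix c d x y z :: complex and r :: real
  show "c *\<^sub>C (x + y) = c *\<^sub>C x + c *\<^sub>C y" "(c + d) *\<^sub>C x = c *\<^sub>C x + d *\<^sub>C x"
    "c *\<^sub>C d *\<^sub>C x = (c * d) *\<^sub>C x" "r *\<^sub>R x = complex_of_real r *\<^sub>C x"
    by (simp_all add: scaleC_complex_def algebra_simps scaleR_conv_of_real)
  show "cinner (x + y) z = cinner x z + cinner y z" "cinner (c *\<^sub>C x) y = c * cinner x y"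
    "cinner x y = cnj (cinner y x)"
    by (simp_all add: scaleC_complex_def cinner_complex_def algebra_simps)
  show "cinner x x = complex_of_real ((norm x)\<^sup>2)"
    unfolding cinner_complex_def by (rule complex_norm_square[symmetric])
qed
end

lemma norm_scaleC: "norm (c *\<^sub>C (x :: 'a::complex_inner)) = norm c * norm x"
proof -
  have "complex_of_real ((norm (c *\<^sub>C x))\<^sup>2) = c * cinner x (c *\<^sub>C x)"
    by (metis cinner_self cinner_scaleC_left)
  also have "\<dots> = c * cnj c * cinner x x"
    by (subst cinner_commute) (simp add: cinner_scaleC_left cinner_self)
  also have "\<dots> = complex_of_real ((norm c * norm x)\<^sup>2)"
    by (simp add: cinner_self complex_norm_square[symmetric] power_mult_distrib
        del: of_real_power of_real_mult flip: of_real_power of_real_mult)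
  finally have "(norm (c *\<^sub>C x))\<^sup>2 = (norm c * norm x)\<^sup>2"
    by (simp only: of_real_eq_iff)
  then show ?thesis by (simp add: power2_eq_iff_nonneg)
qed

lemma bounded_linear_scaleC: "bounded_linear (\<lambda>x :: 'a::complex_inner. c *\<^sub>C x)"
  by (rule bounded_linear_intro[where K = "norm c"])
    (simp_all add: scaleC_add_right scaleR_scaleC scaleC_scaleC norm_scaleC mult.commute)


section \<open>The normed algebra of bounded linear operators\<close>

text \<open>
  \<open>blinfun\<close> provides the bounded real-linear maps with the operator norm; the complex-linear
  ones among them form the algebra of bounded operators of the space.
\<close>

typedef (overloaded) 'a bounded_op =
  "{T :: 'a::complex_inner \<Rightarrow>\<^sub>L 'a. \<forall>c x. blinfun_apply T (c *\<^sub>C x) = c *\<^sub>C blinfun_apply T x}"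
  by (rule exI[where x = 0]) simp

setup_lifting type_definition_bounded_op

lift_definition op_apply :: "'a::complex_inner bounded_op \<Rightarrow> 'a \<Rightarrow> 'a" is blinfun_apply .

instantiation bounded_op :: (complex_inner) real_normed_algebra
begin
lift_definition zero_bounded_op :: "'a bounded_op" is 0 by simp
lift_definition plus_bounded_op :: "'a bounded_op \<Rightarrow> 'a bounded_op \<Rightarrow> 'a bounded_op"
  is "(+)" by (simp add: blinfun.add_left scaleC_add_right)
lift_definition minus_bounded_op :: "'a bounded_op \<Rightarrow> 'a bounded_op \<Rightarrow> 'a bounded_op"
  is "(-)" by (simp add: blinfun.diff_left complex_vector.scale_right_diff_distrib)
lift_definition uminus_bounded_op :: "'a bounded_op \<Rightarrow> 'a bounded_op"
  is uminus by (simp add: blinfun.minus_left)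
lift_definition scaleR_bounded_op :: "real \<Rightarrow> 'a bounded_op \<Rightarrow> 'a bounded_op"
  is scaleR by (simp add: blinfun.scaleR_left scaleR_scaleC scaleC_scaleC mult.commute)
lift_definition times_bounded_op :: "'a bounded_op \<Rightarrow> 'a bounded_op \<Rightarrow> 'a bounded_op"
  is blinfun_compose by simp
lift_definition norm_bounded_op :: "'a bounded_op \<Rightarrow> real" is norm .
definition sgn_bounded_op :: "'a bounded_op \<Rightarrow> 'a bounded_op" where
  "sgn_bounded_op A = inverse (norm A) *\<^sub>R A"
definition dist_bounded_op :: "'a bounded_op \<Rightarrow> 'a bounded_op \<Rightarrow> real" where
  "dist_bounded_op A B = norm (A - B)"
definition uniformity_bounded_op :: "('a bounded_op \<times> 'a bounded_op) filter" where
  "uniformity_bounded_op = (INF e\<in>{0<..}. principal {(A, B). dist A B < e})"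
definition open_bounded_op :: "'a bounded_op set \<Rightarrow> bool" where
  "open_bounded_op S = (\<forall>A\<in>S. \<forall>\<^sub>F (A', B) in uniformity. A' = A \<longrightarrow> B \<in> S)"
instance
proof
  fix A B C :: "'a bounded_op" and r s :: real
  show "A + B + C = A + (B + C)" "A + B = B + A" "0 + A = A" "- A + A = 0" "A - B = A + - B"
    by (transfer; simp add: algebra_simps)+
  show "r *\<^sub>R (A + B) = r *\<^sub>R A + r *\<^sub>R B" "(r + s) *\<^sub>R A = r *\<^sub>R A + s *\<^sub>R A"
    "r *\<^sub>R s *\<^sub>R A = (r * s) *\<^sub>R A" "1 *\<^sub>R A = A"
    by (transfer; simp add: algebra_simps)+
  show "A * B * C = A * (B * C)" "(A + B) * C = A * C + B * C" "A * (B + C) = A * B + A * C"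
    "(r *\<^sub>R A) * B = r *\<^sub>R (A * B)" "A * (r *\<^sub>R B) = r *\<^sub>R (A * B)"
    by (transfer; auto intro!: blinfun_eqI simp: blinfun.bilinear_simps)+
  show "norm (A * B) \<le> norm A * norm B"
    by transfer (rule norm_blinfun_compose)
  show "norm A = 0 \<longleftrightarrow> A = 0" "norm (r *\<^sub>R A) = \<bar>r\<bar> * norm A"
    by (transfer; simp)+
  show "norm (A + B) \<le> norm A + norm B"
    by transfer (rule norm_triangle_ineq)
qed (rule sgn_bounded_op_def dist_bounded_op_def uniformity_bounded_op_def open_bounded_op_def)+
end

instantiation bounded_op :: (complex_inner) monoid_mult
begin
lift_definition one_bounded_op :: "'a bounded_op" is id_blinfun by simp
instance
  by standard (transfer; auto intro!: blinfun_eqI)+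
end

instantiation bounded_op :: (complex_inner) complex_vector
begin
lift_definition scaleC_bounded_op :: "complex \<Rightarrow> 'a bounded_op \<Rightarrow> 'a bounded_op"
  is "\<lambda>c T. Blinfun (scaleC c) o\<^sub>L T"
  by (simp add: bounded_linear_Blinfun_apply[OF bounded_linear_scaleC] scaleC_scaleC mult.commute)
instance
proof
  fix A B :: "'a bounded_op" and c d :: complex and r :: real
  show "c *\<^sub>C (A + B) = c *\<^sub>C A + c *\<^sub>C B"
    by transfer (rule blinfun_eqI, simp add: bounded_linear_Blinfun_apply[OF bounded_linear_scaleC]
      blinfun.add_left scaleC_add_right)
  show "(c + d) *\<^sub>C A = c *\<^sub>C A + d *\<^sub>C A"
    by transfer (rule blinfun_eqI, simp add: bounded_linear_Blinfun_apply[OF bounded_linear_scaleC]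
      blinfun.add_left scaleC_add_left)
  show "c *\<^sub>C d *\<^sub>C A = (c * d) *\<^sub>C A"
    by transfer (rule blinfun_eqI, simp add: bounded_linear_Blinfun_apply[OF bounded_linear_scaleC]
      scaleC_scaleC)
  show "r *\<^sub>R A = complex_of_real r *\<^sub>C A"
    by transfer (rule blinfun_eqI, simp add: bounded_linear_Blinfun_apply[OF bounded_linear_scaleC]
      blinfun.scaleR_left scaleR_scaleC)
qed
end


section \<open>Positive operators, inverses, and positive maps\<close>

definition self_adjoint :: "'a::complex_inner bounded_op \<Rightarrow> bool" where
  "self_adjoint A \<longleftrightarrow> (\<forall>x y. cinner (op_apply A x) y = cinner x (op_apply A y))"

definition positive_op :: "'a::complex_inner bounded_op \<Rightarrow> bool" where
  "positive_op A \<longleftrightarrow> (\<forall>x. cinner (op_apply A x) x \<in> \<real>\<^sub>\<ge>\<^sub>0)"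

definition loewner_le :: "'a::complex_inner bounded_op \<Rightarrow> 'a bounded_op \<Rightarrow> bool"
  (infix \<open>\<preceq>\<close> 50) where
  "A \<preceq> B \<longleftrightarrow> self_adjoint A \<and> self_adjoint B \<and> positive_op (B - A)"

definition op_invertible :: "'a::complex_inner bounded_op \<Rightarrow> bool" where
  "op_invertible A \<longleftrightarrow> (\<exists>B. A * B = 1 \<and> B * A = 1)"

definition op_inverse :: "'a::complex_inner bounded_op \<Rightarrow> 'a bounded_op" where
  "op_inverse A = (THE B. A * B = 1 \<and> B * A = 1)"

definition positive_map ::
  "('a::complex_inner bounded_op \<Rightarrow> 'b::complex_inner bounded_op) \<Rightarrow> bool" where
  "positive_map \<Phi> \<longleftrightarrow> (\<forall>A. positive_op A \<longrightarrow> positive_op (\<Phi> A))"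

definition normalized_map ::
  "('a::complex_inner bounded_op \<Rightarrow> 'b::complex_inner bounded_op) \<Rightarrow> bool" where
  "normalized_map \<Phi> \<longleftrightarrow> \<Phi> 1 = 1"


section \<open>Continuous functional calculus\<close>

definition spectrum_op :: "'a::complex_inner bounded_op \<Rightarrow> complex set" where
  "spectrum_op A = {z. \<not> op_invertible (A - z *\<^sub>C 1)}"

definition poly_op :: "real poly \<Rightarrow> 'a::complex_inner bounded_op \<Rightarrow> 'a bounded_op" where
  "poly_op p A = (\<Sum>i\<le>degree p. coeff p i *\<^sub>R A ^ i)"

text \<open>
  For self-adjoint \<open>A\<close> on a Hilbert space and \<open>f\<close> continuous on the spectrum of \<open>A\<close>, which is a
  compact subset of the real line, \<open>f(A)\<close> is the limit in operator norm of \<open>p\<^sub>n(A)\<close> for real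
  polynomials \<open>p\<^sub>n\<close> converging to \<open>f\<close> uniformly on the spectrum. Only the values of \<open>f\<close> on the
  spectrum matter. For other \<open>A\<close> or \<open>f\<close> the value is not meaningful.
\<close>

definition cfc :: "(real \<Rightarrow> real) \<Rightarrow> 'a::complex_inner bounded_op \<Rightarrow> 'a bounded_op" where
  "cfc f A = (THE B. \<exists>p :: nat \<Rightarrow> real poly.
     uniform_limit {t. complex_of_real t \<in> spectrum_op A} (\<lambda>n. poly (p n)) f sequentially \<and>
     (\<lambda>n. poly_op (p n) A) \<longlonglongrightarrow> B)"

end

theory Submission
  imports Defs "HOL-Computational_Algebra.Fundamental_Theorem_Algebra"
begin

text \<open>
  The function \<open>g(t) = m powr ((t - M) / (M - m)) * M powr ((m - t) / (M - m))\<close> is the geometric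
  interpolation of \<open>1/m\<close> and \<open>1/M\<close>. Concavity of the logarithm gives \<open>1/t \<le> g(t)\<close>, and the
  weighted arithmetic-geometric mean inequality gives \<open>g(t) \<le> (M + m - t) / (M m)\<close> on \<open>[m, M]\<close>.
  The functional calculus is monotone, so both bounds pass to \<open>A\<close> and then to \<open>\<Phi>\<close>; since the upper
  one is affine in \<open>A\<close>, it becomes \<open>(M + m - B) / (M m)\<close> with \<open>B = \<Phi>(A)\<close>, and
  \<open>(M + m) - B \<le> ((M + m)\<^sup>2 / 4) B\<^sup>-\<^sup>1\<close> by completing the square.

  The functional calculus rests on two facts: a real polynomial that is nonnegative on the
  spectrum of a self-adjoint \<open>A\<close> is positive at \<open>A\<close>, because the bottom of the numerical range
  of \<open>p(A)\<close> lies in the spectrum of \<open>p(A)\<close> and so is a value of \<open>p\<close> on the spectrum of \<open>A\<close>; hence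
  \<open>\<parallel>p(A)\<parallel>\<close> is bounded by the supremum of \<open>\<bar>p\<bar>\<close> there.
\<close>

section \<open>Inner products\<close>

instance complex_hilbert \<subseteq> banach ..

lemma cinner_add_right: "cinner x (y + z) = cinner x y + cinner x (z :: 'a::complex_inner)"
  by (metis cinner_add_left cinner_commute complex_cnj_add)

lemma cinner_scaleC_right: "cinner x (c *\<^sub>C y) = cnj c * cinner x (y :: 'a::complex_inner)"
  by (metis cinner_commute cinner_scaleC_left complex_cnj_mult)

lemma cinner_scaleR_left: "cinner (r *\<^sub>R x) y = of_real r * cinner x (y :: 'a::complex_inner)"
  by (simp add: scaleR_scaleC cinner_scaleC_left)

lemma cinner_scaleR_right: "cinner x (r *\<^sub>R y) = of_real r * cinner x (y :: 'a::complex_inner)"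
  by (simp add: scaleR_scaleC cinner_scaleC_right)

lemma cinner_minus_left: "cinner (- x) y = - cinner x (y :: 'a::complex_inner)"
  using cinner_scaleR_left[of "-1" x y] by simp

lemma cinner_minus_right: "cinner x (- y) = - cinner x (y :: 'a::complex_inner)"
  using cinner_scaleR_right[of x "-1" y] by simp

lemma cinner_diff_left: "cinner (x - y) z = cinner x z - cinner y (z :: 'a::complex_inner)"
  using cinner_add_left[of x "- y" z] by (simp add: cinner_minus_left)

lemma cinner_diff_right: "cinner x (y - z) = cinner x y - cinner x (z :: 'a::complex_inner)"
  using cinner_add_right[of x y "- z"] by (simp add: cinner_minus_right)

lemma cinner_zero_left: "cinner 0 (x :: 'a::complex_inner) = 0"
  using cinner_scaleR_left[of 0 x x] by simp

lemma cinner_zero_right: "cinner (x :: 'a::complex_inner) 0 = 0"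
  using cinner_scaleR_right[of x 0 x] by simp

lemmas cinner_simps = cinner_add_left cinner_add_right cinner_scaleC_left cinner_scaleC_right
  cinner_scaleR_left cinner_scaleR_right cinner_minus_left cinner_minus_right
  cinner_diff_left cinner_diff_right cinner_zero_left cinner_zero_right

lemma Re_cinner_commute: "Re (cinner x y) = Re (cinner y (x :: 'a::complex_inner))"
  by (metis cinner_commute complex_cnj(1) complex.sel(1) cnj.sel(1))

lemma Re_cinner_self: "Re (cinner x x) = (norm (x :: 'a::complex_inner))\<^sup>2"
  by (simp add: cinner_self)

text \<open>Each vector is scaled by the norm of the other, so that the expanded square of the
  difference factors as \<open>2 * (?a * ?b) * (?a * ?b - Re (cinner x y))\<close>.\<close>

lemma Re_cinner_le: "Re (cinner x y) \<le> norm x * norm (y :: 'a::complex_inner)"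
proof (cases "x = 0 \<or> y = 0")
  case True
  then show ?thesis by (auto simp: cinner_simps)
next
  case False
  let ?a = "norm x" and ?b = "norm y"
  have "0 \<le> Re (cinner (?b *\<^sub>R x - ?a *\<^sub>R y) (?b *\<^sub>R x - ?a *\<^sub>R y))"
    by (simp add: Re_cinner_self)
  also have "\<dots> = 2 * (?a * ?b) * (?a * ?b - Re (cinner x y))"
    by (simp add: cinner_simps Re_cinner_self Re_cinner_commute[of y x] power2_eq_square
        algebra_simps)
  finally have "0 \<le> 2 * (?a * ?b) * (?a * ?b - Re (cinner x y))" .
  moreover have "0 < ?a * ?b"
    using False by simp
  ultimately show ?thesis
    unfolding zero_le_mult_iff by linarith
qed

lemma norm_cinner_le: "norm (cinner x y) \<le> norm x * norm (y :: 'a::complex_inner)"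
proof (cases "cinner x y = 0")
  case False
  \<comment> \<open>A unimodular factor rotating the inner product onto the positive real axis,
    which reduces the modulus to the real part.\<close>
  define c where "c = cnj (sgn (cinner x y))"
  have "c * cinner x y = of_real (norm (cinner x y))"
    using False
    by (simp add: c_def sgn_div_norm scaleR_conv_of_real complex_norm_square[symmetric] power2_eq_square
        field_simps)
  then have "norm (cinner x y) = Re (cinner (c *\<^sub>C x) y)"
    by (simp add: cinner_scaleC_left)
  also have "\<dots> \<le> norm (c *\<^sub>C x) * norm y"
    by (rule Re_cinner_le)
  also have "\<dots> = norm x * norm y"
    using False by (simp add: norm_scaleC c_def norm_sgn)
  finally show ?thesis .
qed simp

lemma bounded_bilinear_cinner:
  "bounded_bilinear (cinner :: 'a::complex_inner \<Rightarrow> 'a \<Rightarrow> complex)"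
proof
  show "\<exists>K. \<forall>a b :: 'a. norm (cinner a b) \<le> norm a * norm b * K"
    by (rule exI[of _ 1]) (simp add: norm_cinner_le)
qed (simp_all add: cinner_simps scaleR_conv_of_real)

section \<open>The algebra of bounded operators\<close>

lemma bounded_op_eqI: "(\<And>x. op_apply A x = op_apply B x) \<Longrightarrow> A = B"
  by transfer (rule blinfun_eqI)

lemma op_apply_simps:
  "op_apply (A + B) x = op_apply A x + op_apply B x"
  "op_apply (A - B) x = op_apply A x - op_apply B x"
  "op_apply (- A) x = - op_apply A x"
  "op_apply 0 x = 0"
  "op_apply (A * B) x = op_apply A (op_apply B x)"
  "op_apply 1 x = x"
  "op_apply (r *\<^sub>R A) x = r *\<^sub>R op_apply A x"
  "op_apply (c *\<^sub>C A) x = c *\<^sub>C op_apply A x"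
  by (transfer; simp add: blinfun.bilinear_simps bounded_linear_Blinfun_apply[OF bounded_linear_scaleC])+

lemma op_apply_arg_simps:
  "op_apply A (x + y) = op_apply A x + op_apply A y"
  "op_apply A (x - y) = op_apply A x - op_apply A y"
  "op_apply A (- x) = - op_apply A x"
  "op_apply A 0 = 0"
  "op_apply A (r *\<^sub>R x) = r *\<^sub>R op_apply A x"
  "op_apply A (c *\<^sub>C x) = c *\<^sub>C op_apply A x"
  by (transfer; simp add: blinfun.bilinear_simps)+

lemma norm_op_apply: "norm (op_apply A x) \<le> norm A * norm x"
  by transfer (rule norm_blinfun)

lemma norm_bounded_op_bound:
  "0 \<le> b \<Longrightarrow> (\<And>x. norm (op_apply A x) \<le> b * norm x) \<Longrightarrow> norm A \<le> b"
  by transfer (rule norm_blinfun_bound)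

lemma scaleC_times_left: "(c *\<^sub>C A) * B = c *\<^sub>C (A * B :: 'a::complex_inner bounded_op)"
  by (rule bounded_op_eqI) (simp add: op_apply_simps)

lemma scaleC_times_right: "A * (c *\<^sub>C B) = c *\<^sub>C (A * B :: 'a::complex_inner bounded_op)"
  by (rule bounded_op_eqI) (simp add: op_apply_simps op_apply_arg_simps)

lemma bounded_bilinear_op_apply:
  "bounded_bilinear (op_apply :: 'a::complex_inner bounded_op \<Rightarrow> 'a \<Rightarrow> 'a)"
proof
  show "\<exists>K. \<forall>A (x :: 'a). norm (op_apply A x) \<le> norm A * norm x * K"
    by (rule exI[of _ 1]) (simp add: norm_op_apply)
qed (simp_all add: op_apply_simps op_apply_arg_simps)

lemma tendsto_cinner_op_apply:
  "(X \<longlongrightarrow> A) F \<Longrightarrow> ((\<lambda>n. cinner (op_apply (X n) x) y) \<longlongrightarrow> cinner (op_apply A x) y) F"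
  by (intro bounded_bilinear.tendsto[OF bounded_bilinear_cinner]
      bounded_bilinear.tendsto[OF bounded_bilinear_op_apply] tendsto_const)

text \<open>Completeness is inherited from \<open>blinfun\<close>: complex homogeneity survives
  pointwise limits, so the complex-linear maps form a closed subspace.\<close>

instance bounded_op :: (complex_hilbert) banach
proof
  fix X :: "nat \<Rightarrow> 'a bounded_op"
  assume "Cauchy X"
  then have "Cauchy (\<lambda>n. Rep_bounded_op (X n))"
    unfolding Cauchy_def dist_norm
    by (simp add: norm_bounded_op.rep_eq minus_bounded_op.rep_eq)
  then obtain T where T: "(\<lambda>n. Rep_bounded_op (X n)) \<longlonglongrightarrow> T"
    by (auto simp: Cauchy_convergent_iff convergent_def)
  have apply_T: "(\<lambda>n. blinfun_apply (Rep_bounded_op (X n)) x) \<longlonglongrightarrow> blinfun_apply T x" for x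
    by (intro blinfun.tendsto T tendsto_const)
  have "blinfun_apply T (c *\<^sub>C x) = c *\<^sub>C blinfun_apply T x" for c x
  proof (rule LIMSEQ_unique[OF apply_T])
    have "blinfun_apply (Rep_bounded_op (X n)) (c *\<^sub>C x)
        = c *\<^sub>C blinfun_apply (Rep_bounded_op (X n)) x" for n
      using Rep_bounded_op[of "X n"] by simp
    then show "(\<lambda>n. blinfun_apply (Rep_bounded_op (X n)) (c *\<^sub>C x)) \<longlonglongrightarrow> c *\<^sub>C blinfun_apply T x"
      using bounded_linear.tendsto[OF bounded_linear_scaleC apply_T] by simp
  qed
  then have "Rep_bounded_op (Abs_bounded_op T) = T"
    by (intro Abs_bounded_op_inverse) simp
  with T have "X \<longlonglongrightarrow> Abs_bounded_op T"
    unfolding LIMSEQ_iff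
    by (simp add: norm_bounded_op.rep_eq minus_bounded_op.rep_eq)
  then show "convergent X"
    by (auto simp: convergent_def)
qed

section \<open>Self-adjoint and positive operators\<close>

lemma self_adjointD: "self_adjoint A \<Longrightarrow> cinner (op_apply A x) y = cinner x (op_apply A y)"
  by (simp add: self_adjoint_def)

lemma positive_op_iff:
  "positive_op A \<longleftrightarrow>
    (\<forall>x. 0 \<le> Re (cinner (op_apply A x) x) \<and> Im (cinner (op_apply A x) x) = 0)"
  by (simp add: positive_op_def complex_nonneg_Reals_iff)

lemma positive_opD: "positive_op A \<Longrightarrow> 0 \<le> Re (cinner (op_apply A x) x)"
  by (simp add: positive_op_iff)

lemma Im_cinner_self_adjoint: "self_adjoint A \<Longrightarrow> Im (cinner (op_apply A x) x) = 0"
  by (metis Reals_cnj_iff cinner_commute complex_is_Real_iff self_adjointD)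

lemma positive_opI:
  "self_adjoint A \<Longrightarrow> (\<And>x. 0 \<le> Re (cinner (op_apply A x) x)) \<Longrightarrow> positive_op A"
  by (simp add: positive_op_iff Im_cinner_self_adjoint)

text \<open>Polarization over the complex field: reality of the quadratic form at
  \<open>x + y\<close> settles the imaginary part of the symmetry, and at
  \<open>x + \<i> *\<^sub>C y\<close> the real part.\<close>

lemma positive_imp_self_adjoint:
  assumes "positive_op A"
  shows "self_adjoint A"
  unfolding self_adjoint_def
proof (intro allI)
  fix x y
  have real: "Im (cinner (op_apply A z) z) = 0" for z
    using assms by (simp add: positive_op_iff)
  have "Im (cinner (op_apply A x) y) + Im (cinner (op_apply A y) x) = 0"
    using real[of "x + y"] real[of x] real[of y]
    by (simp add: op_apply_arg_simps cinner_simps)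
  moreover have "Re (cinner (op_apply A x) y) = Re (cinner (op_apply A y) x)"
    using real[of "x + \<i> *\<^sub>C y"] real[of x] real[of y]
    by (simp add: op_apply_arg_simps cinner_simps)
  ultimately have "cinner (op_apply A x) y = cnj (cinner (op_apply A y) x)"
    by (simp add: complex_eq_iff)
  then show "cinner (op_apply A x) y = cinner x (op_apply A y)"
    by (simp flip: cinner_commute)
qed

lemma self_adjoint_one: "self_adjoint 1"
  by (simp add: self_adjoint_def op_apply_simps)

lemma self_adjoint_zero: "self_adjoint 0"
  by (simp add: self_adjoint_def op_apply_simps cinner_simps)

lemma self_adjoint_add: "self_adjoint A \<Longrightarrow> self_adjoint B \<Longrightarrow> self_adjoint (A + B)"
  by (simp add: self_adjoint_def op_apply_simps cinner_simps)

lemma self_adjoint_diff: "self_adjoint A \<Longrightarrow> self_adjoint B \<Longrightarrow> self_adjoint (A - B)"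
  by (simp add: self_adjoint_def op_apply_simps cinner_simps)

lemma self_adjoint_scaleR: "self_adjoint A \<Longrightarrow> self_adjoint (r *\<^sub>R A)"
  by (simp add: self_adjoint_def op_apply_simps cinner_simps)

lemma self_adjoint_times:
  "self_adjoint A \<Longrightarrow> self_adjoint B \<Longrightarrow> A * B = B * A \<Longrightarrow> self_adjoint (A * B)"
  unfolding self_adjoint_def by (metis op_apply_simps(5))

lemmas self_adjoint_intros = self_adjoint_one self_adjoint_zero self_adjoint_add
  self_adjoint_diff self_adjoint_scaleR

lemma self_adjoint_tendsto:
  assumes "X \<longlonglongrightarrow> A" and "\<And>n. self_adjoint (X n)"
  shows "self_adjoint A"
  unfolding self_adjoint_def
proof (intro allI)
  fix x y
  have "(\<lambda>n. cinner (op_apply (X n) x) y) \<longlonglongrightarrow> cinner (op_apply A x) y"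
    by (rule tendsto_cinner_op_apply[OF assms(1)])
  moreover have "(\<lambda>n. cinner x (op_apply (X n) y)) \<longlonglongrightarrow> cinner x (op_apply A y)"
    by (intro bounded_bilinear.tendsto[OF bounded_bilinear_cinner]
        bounded_bilinear.tendsto[OF bounded_bilinear_op_apply] tendsto_const assms(1))
  ultimately show "cinner (op_apply A x) y = cinner x (op_apply A y)"
    using assms(2) by (simp add: self_adjoint_def LIMSEQ_unique)
qed

text \<open>Cauchy-Schwarz for the quadratic form. The bracketing by multiples of the identity keeps
  the numerical range bounded and later writes \<open>A\<close> as a difference of positive
  operators.\<close>

lemma positive_norm_scaleR_one_diff:
  assumes "self_adjoint A"
  shows "positive_op (norm A *\<^sub>R 1 - A)" and "positive_op (norm A *\<^sub>R 1 + A)"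
proof -
  have "\<bar>Re (cinner (op_apply A x) x)\<bar> \<le> norm A * (norm x)\<^sup>2" for x
  proof -
    have "\<bar>Re (cinner (op_apply A x) x)\<bar> \<le> norm (op_apply A x) * norm x"
      using abs_Re_le_cmod norm_cinner_le order_trans by blast
    also have "\<dots> \<le> norm A * norm x * norm x"
      by (intro mult_right_mono norm_op_apply) simp
    finally show ?thesis by (simp add: power2_eq_square mult.assoc)
  qed
  then have "0 \<le> Re (cinner (op_apply (norm A *\<^sub>R 1 - A) x) x)"
    "0 \<le> Re (cinner (op_apply (norm A *\<^sub>R 1 + A) x) x)" for x
    using abs_le_iff[of "Re (cinner (op_apply A x) x)" "norm A * (norm x)\<^sup>2"]
    by (simp_all add: op_apply_simps cinner_simps Re_cinner_self)
  then show "positive_op (norm A *\<^sub>R 1 - A)" "positive_op (norm A *\<^sub>R 1 + A)"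
    using assms by (auto intro!: positive_opI self_adjoint_intros)
qed

text \<open>By self-adjointness the real part of \<open>cinner (op_apply A x) y\<close> is a
  difference of two values of the quadratic form; the parallelogram law then bounds it through the
  norms of \<open>x\<close> and \<open>y\<close>.\<close>

lemma norm_self_adjoint_le:
  assumes sa: "self_adjoint A" and "0 \<le> r"
    and bound: "\<And>x. \<bar>Re (cinner (op_apply A x) x)\<bar> \<le> r * (norm x)\<^sup>2"
  shows "norm A \<le> r"
proof (rule norm_bounded_op_bound[OF \<open>0 \<le> r\<close>])
  fix x
  have polar: "4 * Re (cinner (op_apply A x) y) \<le> 2 * r * ((norm x)\<^sup>2 + (norm y)\<^sup>2)" for x y
  proof -
    have "Re (cinner (op_apply A y) x) = Re (cinner (op_apply A x) y)"
      by (metis Re_cinner_commute sa self_adjointD)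
    then have "4 * Re (cinner (op_apply A x) y)
        = Re (cinner (op_apply A (x + y)) (x + y)) - Re (cinner (op_apply A (x - y)) (x - y))"
      by (simp add: op_apply_arg_simps cinner_simps)
    also have "\<dots> \<le> r * (norm (x + y))\<^sup>2 + r * (norm (x - y))\<^sup>2"
      using bound[of "x + y"] bound[of "x - y"] by linarith
    also have "(norm (x + y))\<^sup>2 = (norm x)\<^sup>2 + (norm y)\<^sup>2 + 2 * Re (cinner x y)"
      using Re_cinner_commute[of y x]
      by (simp add: Re_cinner_self[symmetric] cinner_simps)
    also have "(norm (x - y))\<^sup>2 = (norm x)\<^sup>2 + (norm y)\<^sup>2 - 2 * Re (cinner x y)"
      using Re_cinner_commute[of y x]
      by (simp add: Re_cinner_self[symmetric] cinner_simps)
    finally show ?thesis by (simp add: algebra_simps)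
  qed
  show "norm (op_apply A x) \<le> r * norm x"
  proof (cases "x = 0 \<or> op_apply A x = 0")
    case True
    then show ?thesis using \<open>0 \<le> r\<close> by (auto simp: op_apply_arg_simps)
  next
    case False
    \<comment> \<open>The vector \<open>?s *\<^sub>R op_apply A x\<close> points along
      \<open>op_apply A x\<close> and has the norm of \<open>x\<close>, which makes the polar
      estimate sharp.\<close>
    let ?s = "norm x / norm (op_apply A x)"
    have "4 * (?s * (norm (op_apply A x))\<^sup>2) \<le> 2 * r * ((norm x)\<^sup>2 + (norm x)\<^sup>2)"
      using polar[of x "?s *\<^sub>R op_apply A x"] False by (simp add: cinner_simps Re_cinner_self)
    then show ?thesis
      using False by (simp add: power2_eq_square)
  qed
qed

lemma positive_op_add:
  "positive_op A \<Longrightarrow> positive_op B \<Longrightarrow> positive_op (A + B)"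
  by (simp add: positive_op_iff op_apply_simps cinner_simps)

section \<open>Invertibility and the spectrum\<close>

lemma op_inverse_eqI: "A * B = 1 \<Longrightarrow> B * A = 1 \<Longrightarrow> op_inverse A = B"
  unfolding op_inverse_def by (rule the_equality) (simp, metis mult.assoc mult_1 mult_1_right)

lemma op_inverse_times:
  assumes "op_invertible A"
  shows "A * op_inverse A = 1" and "op_inverse A * A = 1"
  using assms op_inverse_eqI[of A] by (auto simp: op_invertible_def)

lemma op_invertible_mult: "op_invertible A \<Longrightarrow> op_invertible B \<Longrightarrow> op_invertible (A * B)"
  unfolding op_invertible_def by (metis mult.assoc mult_1)

lemma op_invertible_scaleC:
  assumes "op_invertible A" and "c \<noteq> 0"
  shows "op_invertible (c *\<^sub>C A)"
proof -
  obtain B where "A * B = 1" "B * A = 1"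
    using assms(1) by (auto simp: op_invertible_def)
  then have "(c *\<^sub>C A) * (inverse c *\<^sub>C B) = 1" "(inverse c *\<^sub>C B) * (c *\<^sub>C A) = 1"
    using assms(2) by (simp_all add: scaleC_times_left scaleC_times_right scaleC_scaleC scaleC_one)
  then show ?thesis by (auto simp: op_invertible_def)
qed

lemma op_invertible_scaleC_iff:
  assumes "c \<noteq> 0"
  shows "op_invertible (c *\<^sub>C A) \<longleftrightarrow> op_invertible A"
proof
  assume "op_invertible (c *\<^sub>C A)"
  then have "op_invertible (inverse c *\<^sub>C c *\<^sub>C A)"
    by (rule op_invertible_scaleC) (simp add: assms)
  then show "op_invertible A"
    using assms by (simp add: scaleC_scaleC scaleC_one)
qed (rule op_invertible_scaleC[OF _ assms])

section \<open>Invertibility from contraction and coercivity\<close>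

text \<open>The inverse is the geometric series; its partial sums telescope against
  \<open>1 - S\<close> from either side.\<close>

lemma neumann_invertible:
  fixes S :: "'a::complex_hilbert bounded_op"
  assumes "norm S < 1"
  shows "op_invertible (1 - S)"
proof -
  \<comment> \<open>Exponents start at 1 because \<open>norm 1\<close> is 0 on the zero space, so
    \<open>norm 1 = 1\<close> cannot be relied on.\<close>
  have pow: "norm (S ^ Suc n) \<le> norm S ^ Suc n" for n
  proof (induction n)
    case (Suc n)
    have "norm (S ^ Suc (Suc n)) \<le> norm S * norm (S ^ Suc n)"
      by (simp add: norm_mult_ineq)
    also have "\<dots> \<le> norm S * norm S ^ Suc n"
      by (intro mult_left_mono Suc.IH) simp
    finally show ?case by simp
  qed simp
  have sumS: "summable (\<lambda>n. S ^ Suc n)"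
  proof (rule summable_comparison_test')
    show "summable (\<lambda>n. norm S * norm S ^ n)"
      using assms by (intro summable_mult summable_geometric) simp
    show "norm (S ^ Suc n) \<le> norm S * norm S ^ n" if "n \<ge> 0" for n
      using pow[of n] by simp
  qed
  then have lim0: "(\<lambda>n. S ^ n) \<longlonglongrightarrow> 0"
    using summable_LIMSEQ_zero LIMSEQ_imp_Suc by blast
  define X where "X n = (\<Sum>i<n. S ^ i)" for n
  have "summable (\<lambda>n. S ^ n)"
    using sumS summable_Suc_iff by blast
  then obtain B where B: "X \<longlonglongrightarrow> B"
    unfolding X_def summable_def sums_def by auto
  have X_Suc: "X 0 = 0" "X (Suc n) = X n + S ^ n" for n
    by (simp_all add: X_def)
  have left: "(1 - S) * X n = 1 - S ^ n" for n
    by (induction n) (simp_all add: X_Suc distrib_left left_diff_distrib)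
  have right: "X n * (1 - S) = 1 - S ^ n" for n
  proof (induction n)
    case (Suc n)
    have "X (Suc n) * (1 - S) = X n * (1 - S) + S ^ n * (1 - S)"
      by (simp only: X_Suc distrib_right)
    also have "\<dots> = 1 - S ^ n + (S ^ n - S ^ Suc n)"
      unfolding Suc.IH by (simp add: right_diff_distrib power_commutes)
    finally show ?case by simp
  qed (simp add: X_Suc)
  have lim1: "(\<lambda>n. 1 - S ^ n) \<longlonglongrightarrow> 1"
    using tendsto_diff[OF tendsto_const lim0, of 1] by simp
  have "(1 - S) * B = 1"
    using tendsto_mult[OF tendsto_const B, of "1 - S"] lim1 LIMSEQ_unique
    unfolding left by blast
  moreover have "B * (1 - S) = 1"
    using tendsto_mult[OF B tendsto_const, of "1 - S"] lim1 LIMSEQ_unique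
    unfolding right by blast
  ultimately show ?thesis by (auto simp: op_invertible_def)
qed

text \<open>For a suitable step \<open>\<tau>\<close> the operator
  \<open>1 - \<tau> *\<^sub>R T\<close> is a strict contraction, as in the Lax-Milgram theorem. It
  covers non-self-adjoint \<open>T\<close>, which is how non-real spectral points are
  excluded.\<close>

lemma coercive_invertible:
  fixes T :: "'a::complex_hilbert bounded_op"
  assumes "0 < c" and coercive: "\<And>x. c * (norm x)\<^sup>2 \<le> Re (cinner (op_apply T x) x)"
  shows "op_invertible T"
proof -
  \<comment> \<open>The maximum with \<open>c\<close> keeps \<open>N\<close> positive and ensures
    \<open>0 \<le> q\<close> below.\<close>
  define N where "N = max c (norm T)"
  have N: "0 < N" "c \<le> N" "norm T \<le> N"
    using \<open>0 < c\<close> by (auto simp: N_def)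
  \<comment> \<open>This \<open>\<tau>\<close> minimizes
    \<open>1 - 2 * \<tau> * c + \<tau>\<^sup>2 * N\<^sup>2\<close>; the minimum is
    \<open>q\<close>.\<close>
  define \<tau> where "\<tau> = c / N\<^sup>2"
  have "\<tau> > 0" using N \<open>0 < c\<close> by (simp add: \<tau>_def)
  define q where "q = 1 - c\<^sup>2 / N\<^sup>2"
  have q: "0 \<le> q" "q < 1"
    using N \<open>0 < c\<close> by (simp_all add: q_def power_mono)
  have bound: "norm (op_apply (1 - \<tau> *\<^sub>R T) x) \<le> sqrt q * norm x" for x
  proof -
    have "norm (op_apply T x) \<le> N * norm x"
      using norm_op_apply[of T x] N by (meson mult_right_mono norm_ge_zero order_trans)
    then have Tx: "(norm (op_apply T x))\<^sup>2 \<le> N\<^sup>2 * (norm x)\<^sup>2"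
      by (metis norm_ge_zero power_mono power_mult_distrib)
    have "(norm (op_apply (1 - \<tau> *\<^sub>R T) x))\<^sup>2
        = (norm x)\<^sup>2 - 2 * \<tau> * Re (cinner (op_apply T x) x) + \<tau>\<^sup>2 * (norm (op_apply T x))\<^sup>2"
      using Re_cinner_commute[of x "op_apply T x"]
      unfolding Re_cinner_self[symmetric]
      by (simp add: op_apply_simps cinner_simps power2_eq_square algebra_simps)
    also have "\<dots> \<le> (norm x)\<^sup>2 - 2 * \<tau> * (c * (norm x)\<^sup>2) + \<tau>\<^sup>2 * (N\<^sup>2 * (norm x)\<^sup>2)"
      using \<open>\<tau> > 0\<close> by (intro add_mono diff_mono mult_left_mono coercive Tx) auto
    also have "\<dots> = q * (norm x)\<^sup>2"
      using N by (simp add: q_def \<tau>_def field_simps power2_eq_square)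
    also have "\<dots> = (sqrt q * norm x)\<^sup>2"
      using q by (simp add: power_mult_distrib)
    finally show ?thesis
      using q by (simp add: power2_le_iff_abs_le)
  qed
  have "norm (1 - \<tau> *\<^sub>R T) \<le> sqrt q"
    using bound q by (intro norm_bounded_op_bound) auto
  also have "\<dots> < 1" using q by simp
  finally have "op_invertible (1 - (1 - \<tau> *\<^sub>R T))"
    by (rule neumann_invertible)
  then show ?thesis
    using \<open>\<tau> > 0\<close> by (simp add: scaleR_scaleC op_invertible_scaleC_iff)
qed

section \<open>Location of the spectrum\<close>

text \<open>After multiplication by \<open>\<i> * of_real (Im z)\<close>, the form of
  \<open>A\<close> and the real part of \<open>z\<close> contribute only imaginary terms; what
  remains is coercive with constant \<open>(Im z)\<^sup>2\<close>.\<close>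

lemma spectrum_self_adjoint_real:
  fixes A :: "'a::complex_hilbert bounded_op"
  assumes sa: "self_adjoint A" and "z \<in> spectrum_op A"
  shows "Im z = 0"
proof (rule ccontr)
  assume "Im z \<noteq> 0"
  have "Re (cinner (op_apply ((\<i> * of_real (Im z)) *\<^sub>C (A - z *\<^sub>C 1)) x) x) = (Im z)\<^sup>2 * (norm x)\<^sup>2" for x
    using Im_cinner_self_adjoint[OF sa, of x]
    by (simp add: op_apply_simps cinner_simps cinner_self power2_eq_square algebra_simps)
  then have "op_invertible ((\<i> * of_real (Im z)) *\<^sub>C (A - z *\<^sub>C 1))"
    using \<open>Im z \<noteq> 0\<close> by (intro coercive_invertible[of "(Im z)\<^sup>2"]) auto
  then have "op_invertible (A - z *\<^sub>C 1)"
    using \<open>Im z \<noteq> 0\<close> by (simp add: op_invertible_scaleC_iff)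
  with assms(2) show False by (simp add: spectrum_op_def)
qed

lemma loewner_lower_bound:
  "a *\<^sub>R 1 \<preceq> A \<Longrightarrow> a * (norm x)\<^sup>2 \<le> Re (cinner (op_apply A x) x)"
  using positive_opD[of "A - a *\<^sub>R 1" x]
  by (simp add: loewner_le_def op_apply_simps cinner_simps Re_cinner_self)

lemma loewner_upper_bound:
  "A \<preceq> b *\<^sub>R 1 \<Longrightarrow> Re (cinner (op_apply A x) x) \<le> b * (norm x)\<^sup>2"
  using positive_opD[of "b *\<^sub>R 1 - A" x]
  by (simp add: loewner_le_def op_apply_simps cinner_simps Re_cinner_self)

text \<open>For \<open>t\<close> outside the interval, \<open>A - t\<close> or its negative is
  coercive, with the distance from \<open>t\<close> to the interval as constant.\<close>

lemma spectrum_subset_interval: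
  fixes A :: "'a::complex_hilbert bounded_op"
  assumes "a *\<^sub>R 1 \<preceq> A" and "A \<preceq> b *\<^sub>R 1"
  shows "{t. complex_of_real t \<in> spectrum_op A} \<subseteq> {a..b}"
proof (rule subsetI, rule ccontr)
  fix t assume t: "t \<in> {t. complex_of_real t \<in> spectrum_op A}" "t \<notin> {a..b}"
  have "op_invertible (A - complex_of_real t *\<^sub>C 1)"
  proof (cases "t < a")
    case True
    then show ?thesis
      using loewner_lower_bound[OF assms(1)]
      by (intro coercive_invertible[of "a - t"])
        (auto simp: op_apply_simps cinner_simps cinner_self algebra_simps)
  next
    case False
    with t have "b < t" by simp
    then have "op_invertible ((-1) *\<^sub>C (A - complex_of_real t *\<^sub>C 1))"
      using loewner_upper_bound[OF assms(2)]
      by (intro coercive_invertible[of "t - b"])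
        (auto simp: op_apply_simps cinner_simps cinner_self algebra_simps)
    then show ?thesis
      by (subst (asm) op_invertible_scaleC_iff) auto
  qed
  with t show False by (simp add: spectrum_op_def)
qed

text \<open>A left inverse bounds \<open>norm x\<close> by a multiple of
  \<open>norm (op_apply S x)\<close>. Positivity converts this into a bound on the form through
  \<open>(norm ?y)\<^sup>2 \<le> N * Re (cinner ?y x)\<close>, with no appeal to a square root of
  \<open>S\<close>.\<close>

lemma positive_invertible_imp_coercive:
  assumes pos: "positive_op S" and "op_invertible S"
  shows "\<exists>c>0. \<forall>x. c * (norm x)\<^sup>2 \<le> Re (cinner (op_apply S x) x)"
proof -
  obtain B where B: "B * S = 1"
    using assms(2) by (auto simp: op_invertible_def)
  have sa: "self_adjoint S"
    using pos by (rule positive_imp_self_adjoint)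
  \<comment> \<open>Adding 1 keeps \<open>N\<close> and \<open>D\<close> positive even if the norms
    vanish.\<close>
  define N where "N = norm S + 1"
  define D where "D = norm B + 1"
  have N: "0 < N" and D: "0 < D"
    by (simp_all add: N_def D_def add_nonneg_pos)
  have "(1 / (N * D\<^sup>2)) * (norm x)\<^sup>2 \<le> Re (cinner (op_apply S x) x)" for x
  proof -
    let ?y = "op_apply S x"
    have "x = op_apply B ?y"
      by (metis B op_apply_simps(5,6))
    then have "norm x \<le> norm B * norm ?y"
      by (metis norm_op_apply)
    also have "\<dots> \<le> D * norm ?y"
      by (intro mult_right_mono) (auto simp: D_def)
    finally have x: "(norm x)\<^sup>2 \<le> D\<^sup>2 * (norm ?y)\<^sup>2"
      by (metis norm_ge_zero power_mono power_mult_distrib)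
    have "Re (cinner (op_apply S ?y) ?y) \<le> norm S * (norm ?y)\<^sup>2"
      using positive_opD[OF positive_norm_scaleR_one_diff(1)[OF sa], of ?y]
      by (simp add: op_apply_simps cinner_simps Re_cinner_self)
    also have "\<dots> \<le> N * (norm ?y)\<^sup>2"
      by (intro mult_right_mono) (auto simp: N_def)
    finally have Sy: "Re (cinner (op_apply S ?y) ?y) \<le> N * (norm ?y)\<^sup>2" .
    have "Re (cinner (op_apply S ?y) x) = (norm ?y)\<^sup>2"
      by (simp add: self_adjointD[OF sa, of ?y x] Re_cinner_self)
    \<comment> \<open>The form is evaluated one gradient step away from \<open>x\<close>, at
      \<open>x - (1 / N) *\<^sub>R ?y\<close>; each cross term equals
      \<open>(norm ?y)\<^sup>2 / N\<close> by self-adjointness.\<close>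
    then have "0 \<le> Re (cinner ?y x) - (norm ?y)\<^sup>2 / N - (norm ?y)\<^sup>2 / N
        + Re (cinner (op_apply S ?y) ?y) / N / N"
      using positive_opD[OF pos, of "x - (1 / N) *\<^sub>R ?y"]
      by (simp add: op_apply_arg_simps cinner_simps Re_cinner_self diff_divide_distrib)
    also have "\<dots> \<le> Re (cinner ?y x) - (norm ?y)\<^sup>2 / N - (norm ?y)\<^sup>2 / N
        + N * (norm ?y)\<^sup>2 / N / N"
      using N by (intro add_left_mono divide_right_mono Sy) auto
    also have "\<dots> = Re (cinner ?y x) - (norm ?y)\<^sup>2 / N"
      using N by simp
    finally have "(norm ?y)\<^sup>2 \<le> N * Re (cinner ?y x)"
      using N by (simp add: field_simps)
    then have "D\<^sup>2 * (norm ?y)\<^sup>2 \<le> D\<^sup>2 * (N * Re (cinner ?y x))"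
      by (intro mult_left_mono) auto
    with x have "(norm x)\<^sup>2 \<le> (N * D\<^sup>2) * Re (cinner ?y x)"
      by (simp add: algebra_simps)
    then show ?thesis
      using N D by (simp add: field_simps)
  qed
  then show ?thesis
    using N D by (intro exI[of _ "1 / (N * D\<^sup>2)"]) simp
qed

text \<open>The infimum of the numerical range lies in the spectrum.\<close>

lemma not_positive_imp_negative_spectrum:
  fixes T :: "'a::complex_hilbert bounded_op"
  assumes sa: "self_adjoint T" and "\<not> positive_op T"
  shows "\<exists>\<mu><0. complex_of_real \<mu> \<in> spectrum_op T"
proof -
  obtain x where x: "Re (cinner (op_apply T x) x) < 0"
    using assms positive_opI by (meson not_le)
  then have "x \<noteq> 0" by (auto simp: cinner_simps)
  \<comment> \<open>\<open>L\<close> holds the lower bounds of the numerical range and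
    \<open>u\<close> is a value of that range, so the infimum \<open>Sup L\<close> is at most
    \<open>u < 0\<close>.\<close>
  define L where "L = {\<mu>. \<forall>y. \<mu> * (norm y)\<^sup>2 \<le> Re (cinner (op_apply T y) y)}"
  define u where "u = Re (cinner (op_apply T x) x) / (norm x)\<^sup>2"
  have "u < 0"
    using x \<open>x \<noteq> 0\<close> by (simp add: u_def divide_neg_pos)
  have ub: "\<mu> \<le> u" if "\<mu> \<in> L" for \<mu>
    using that \<open>x \<noteq> 0\<close> by (simp add: L_def u_def field_simps)
  have bdd: "bdd_above L"
    using ub by (auto simp: bdd_above_def)
  have ne: "- norm T \<in> L"
    unfolding L_def
  proof (intro CollectI allI)
    fix y
    show "- norm T * (norm y)\<^sup>2 \<le> Re (cinner (op_apply T y) y)"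
      using positive_opD[OF positive_norm_scaleR_one_diff(2)[OF sa], of y]
      by (simp add: op_apply_simps cinner_simps Re_cinner_self)
  qed
  define s where "s = Sup L"
  have "s \<le> u"
    unfolding s_def using ne ub by (intro cSup_least) auto
  have sL: "s * (norm y)\<^sup>2 \<le> Re (cinner (op_apply T y) y)" for y
  proof (cases "y = 0")
    case False
    have "s \<le> Re (cinner (op_apply T y) y) / (norm y)\<^sup>2"
      unfolding s_def
    proof (rule cSup_least)
      show "L \<noteq> {}" using ne by blast
    qed (use False in \<open>auto simp: L_def field_simps\<close>)
    then show ?thesis using False by (simp add: field_simps)
  qed (simp add: cinner_simps)
  have "complex_of_real s \<in> spectrum_op T"
  proof (rule ccontr)
    assume "complex_of_real s \<notin> spectrum_op T"
    then have inv: "op_invertible (T - s *\<^sub>R 1)"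
      by (simp add: spectrum_op_def scaleR_scaleC)
    have "positive_op (T - s *\<^sub>R 1)"
      using sL by (intro positive_opI self_adjoint_intros sa)
        (simp add: op_apply_simps cinner_simps Re_cinner_self)
    then obtain c where "c > 0" and c: "\<And>y. c * (norm y)\<^sup>2 \<le> Re (cinner (op_apply (T - s *\<^sub>R 1) y) y)"
      using positive_invertible_imp_coercive inv by blast
    \<comment> \<open>Coercivity of \<open>T - s *\<^sub>R 1\<close> would allow the greatest lower
      bound \<open>s\<close> to be raised by \<open>c\<close>.\<close>
    have "s + c \<in> L"
      unfolding L_def using c by (simp add: op_apply_simps cinner_simps Re_cinner_self algebra_simps)
    then have "s + c \<le> s"
      unfolding s_def using bdd by (intro cSup_upper)
    with \<open>c > 0\<close> show False by simp
  qed
  with \<open>s \<le> u\<close> \<open>u < 0\<close> show ?thesis by (intro exI[of _ s]) auto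
qed

section \<open>Polynomials of an operator\<close>

text \<open>Complex coefficients make it possible to split a polynomial into linear factors, which
  real polynomials need not admit.\<close>

definition cpoly_op :: "complex poly \<Rightarrow> 'a::complex_inner bounded_op \<Rightarrow> 'a bounded_op" where
  "cpoly_op p A = (\<Sum>i\<le>degree p. coeff p i *\<^sub>C A ^ i)"

lemma cpoly_op_pCons: "cpoly_op (pCons a p) A = a *\<^sub>C 1 + A * cpoly_op p A"
\<comment> \<open>The degree of \<open>pCons a p\<close> is \<open>Suc (degree p)\<close> only for
  nonzero \<open>p\<close>.\<close>
proof (cases "p = 0")
  case True
  then show ?thesis by (simp add: cpoly_op_def)
next
  case False
  then show ?thesis
    by (simp add: cpoly_op_def sum.atMost_Suc_shift sum_distrib_left scaleC_times_right
        del: sum.atMost_Suc)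
qed

lemma poly_op_pCons: "poly_op (pCons a p) A = a *\<^sub>R 1 + A * poly_op p A"
proof (cases "p = 0")
  case True
  then show ?thesis by (simp add: poly_op_def)
next
  case False
  then show ?thesis
    by (simp add: poly_op_def sum.atMost_Suc_shift sum_distrib_left del: sum.atMost_Suc)
qed

lemma cpoly_op_0 [simp]: "cpoly_op 0 A = 0"
  by (simp add: cpoly_op_def)

lemma poly_op_0 [simp]: "poly_op 0 A = 0"
  by (simp add: poly_op_def)

lemma cpoly_op_of_real: "cpoly_op (map_poly of_real p) A = poly_op p A"
  by (simp add: cpoly_op_def poly_op_def degree_map_poly coeff_map_poly scaleR_scaleC)

lemma poly_map_poly_of_real: "poly (map_poly of_real p) (of_real x) = of_real (poly p x)"
  by (induction p) (simp_all add: map_poly_pCons)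

lemma cpoly_op_diff: "cpoly_op (p - q) A = cpoly_op p A - cpoly_op q A"
  by (induction p q rule: poly_induct2)
    (simp_all add: cpoly_op_pCons right_diff_distrib complex_vector.scale_left_diff_distrib
      add_diff_add)

lemma cpoly_op_smult: "cpoly_op (smult c p) A = c *\<^sub>C cpoly_op p A"
  by (induction p)
    (simp_all add: cpoly_op_pCons scaleC_add_right scaleC_scaleC scaleC_times_right)

lemma cpoly_op_linear_times: "cpoly_op ([:- z, 1:] * p) A = (A - z *\<^sub>C 1) * cpoly_op p A"
proof -
  have "[:- z, 1:] * p = pCons 0 p - smult z p"
    by simp
  then show ?thesis
    by (simp only: cpoly_op_diff cpoly_op_smult cpoly_op_pCons)
      (simp add: scaleC_times_left left_diff_distrib)
qed

lemma poly_op_add: "poly_op (p + q) A = poly_op p A + poly_op q A"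
  by (induction p q rule: poly_induct2)
    (simp_all add: poly_op_pCons distrib_left scaleR_left_distrib ac_simps)

lemma poly_op_diff: "poly_op (p - q) A = poly_op p A - poly_op q A"
  by (induction p q rule: poly_induct2)
    (simp_all add: poly_op_pCons right_diff_distrib scaleR_left_diff_distrib add_diff_add)

lemma poly_op_const: "poly_op [:c:] A = c *\<^sub>R 1"
  by (simp add: poly_op_pCons)

lemma poly_op_commute: "A * poly_op p A = poly_op p A * A"
proof (induction p)
  case (pCons a p)
  show ?case
    by (simp add: poly_op_pCons distrib_left distrib_right mult.assoc pCons.IH[symmetric])
qed simp

lemma self_adjoint_poly_op: "self_adjoint A \<Longrightarrow> self_adjoint (poly_op p A)"
  by (induction p)
    (auto simp: poly_op_pCons intro!: self_adjoint_intros self_adjoint_times poly_op_commute)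

section \<open>Spectral mapping and positivity for polynomials\<close>

text \<open>Induction on the degree: a root \<open>z\<close> splits off the factor
  \<open>A - z *\<^sub>C 1\<close>, which is invertible since \<open>z\<close> is not
  spectral.\<close>

lemma cpoly_op_invertible:
  assumes "p \<noteq> 0" and "\<And>z. poly p z = 0 \<Longrightarrow> z \<notin> spectrum_op A"
  shows "op_invertible (cpoly_op p A)"
  using assms
proof (induction "degree p" arbitrary: p)
  case 0
  then obtain a where p: "p = [:a:]"
    by (metis degree_eq_zeroE)
  have "op_invertible (1 :: 'a bounded_op)"
    by (auto simp: op_invertible_def)
  then show ?case
    using 0 p by (simp add: cpoly_op_pCons op_invertible_scaleC)
next
  case (Suc n)
  then have "\<not> constant (poly p)"
    by (simp add: constant_degree)
  then obtain z where z: "poly p z = 0"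
    using fundamental_theorem_of_algebra by blast
  then obtain q where p: "p = [:- z, 1:] * q"
    by (auto simp: poly_eq_0_iff_dvd dvd_def)
  have "q \<noteq> 0" using Suc.prems p by auto
  moreover have "n = degree q"
    using Suc.hyps(2) \<open>q \<noteq> 0\<close> unfolding p by (subst (asm) degree_mult_eq) auto
  ultimately have "op_invertible (cpoly_op q A)"
    using Suc.prems(2) by (intro Suc.hyps(1)) (auto simp: p)
  moreover have "op_invertible (A - z *\<^sub>C 1)"
    using Suc.prems(2)[OF z] by (simp add: spectrum_op_def)
  ultimately show ?case
    unfolding p cpoly_op_linear_times by (intro op_invertible_mult)
qed

text \<open>Shifting \<open>A\<close> down by more than its norm destroys positivity and so produces
  a spectral point. This serves the constant case of polynomial spectral mapping.\<close>

lemma spectrum_nonempty: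
  fixes A :: "'a::complex_hilbert bounded_op"
  assumes sa: "self_adjoint A" and "(1 :: 'a bounded_op) \<noteq> 0"
  shows "\<exists>t. complex_of_real t \<in> spectrum_op A"
proof -
  obtain x :: 'a where "x \<noteq> 0"
    using assms(2) bounded_op_eqI[of 1 "0 :: 'a bounded_op"] by (force simp: op_apply_simps)
  define c where "c = norm A + 1"
  have "Re (cinner (op_apply (A - c *\<^sub>R 1) x) x) \<le> - ((norm x)\<^sup>2)"
    using positive_opD[OF positive_norm_scaleR_one_diff(1)[OF sa], of x]
    by (simp add: c_def op_apply_simps cinner_simps Re_cinner_self algebra_simps)
  then have "\<not> positive_op (A - c *\<^sub>R 1)"
    using positive_opD[of "A - c *\<^sub>R 1" x] \<open>x \<noteq> 0\<close> by (smt (verit) zero_less_norm_iff zero_less_power)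
  then obtain \<mu> where "complex_of_real \<mu> \<in> spectrum_op (A - c *\<^sub>R 1)"
    using not_positive_imp_negative_spectrum[of "A - c *\<^sub>R 1"]
    by (auto intro: self_adjoint_intros sa)
  then have "complex_of_real (\<mu> + c) \<in> spectrum_op A"
    by (simp add: spectrum_op_def scaleR_scaleC scaleC_add_left algebra_simps)
  then show ?thesis by blast
qed

text \<open>If \<open>p - [:\<mu>:]\<close> is nonzero and had no complex root in the spectrum of
  \<open>A\<close>, its value at \<open>A\<close> would be invertible. The root obtained is real
  because the spectrum is.\<close>

lemma spectrum_poly_op:
  fixes A :: "'a::complex_hilbert bounded_op"
  assumes sa: "self_adjoint A" and \<mu>: "complex_of_real \<mu> \<in> spectrum_op (poly_op p A)"
  shows "\<exists>t. complex_of_real t \<in> spectrum_op A \<and> poly p t = \<mu>"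
proof -
  define q where "q = p - [:\<mu>:]"
  have eval: "cpoly_op (map_poly of_real q) A = poly_op p A - complex_of_real \<mu> *\<^sub>C 1"
    by (simp add: cpoly_op_of_real q_def poly_op_diff poly_op_const scaleR_scaleC)
  then have ninv: "\<not> op_invertible (cpoly_op (map_poly of_real q) A)"
    using \<mu> by (simp add: spectrum_op_def)
  show ?thesis
  proof (cases "q = 0")
    \<comment> \<open>Here \<open>p\<close> is the constant \<open>\<mu>\<close>, so any spectral
      point serves; non-invertibility of the zero operator rules out the zero space.\<close>
    case True
    have "(1 :: 'a bounded_op) \<noteq> 0"
      using ninv True by (auto simp: op_invertible_def)
    then show ?thesis
      using spectrum_nonempty[OF sa] True by (auto simp: q_def)
  next
    case False
    then have "map_poly complex_of_real q \<noteq> 0"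
      by (simp add: map_poly_eq_0_iff)
    then obtain z where z: "poly (map_poly of_real q) z = 0" "z \<in> spectrum_op A"
      using ninv cpoly_op_invertible by blast
    then have "z = complex_of_real (Re z)"
      using spectrum_self_adjoint_real[OF sa] by (simp add: complex_eq_iff)
    with z have "poly q (Re z) = 0" "complex_of_real (Re z) \<in> spectrum_op A"
      by (metis of_real_eq_0_iff poly_map_poly_of_real, simp)
    then show ?thesis by (auto simp: q_def)
  qed
qed

lemma poly_op_positive:
  fixes A :: "'a::complex_hilbert bounded_op"
  assumes "self_adjoint A" and "\<And>t. complex_of_real t \<in> spectrum_op A \<Longrightarrow> 0 \<le> poly p t"
  shows "positive_op (poly_op p A)"
proof (rule ccontr)
  assume "\<not> positive_op (poly_op p A)"
  then obtain \<mu> where "\<mu> < 0" "complex_of_real \<mu> \<in> spectrum_op (poly_op p A)"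
    using not_positive_imp_negative_spectrum self_adjoint_poly_op assms(1) by blast
  then show False
    using spectrum_poly_op[OF assms(1)] assms(2) by force
qed

lemma norm_poly_op_le:
  fixes A :: "'a::complex_hilbert bounded_op"
  assumes sa: "self_adjoint A" and "0 \<le> r"
    and bound: "\<And>t. complex_of_real t \<in> spectrum_op A \<Longrightarrow> \<bar>poly p t\<bar> \<le> r"
  shows "norm (poly_op p A) \<le> r"
proof (rule norm_self_adjoint_le[OF self_adjoint_poly_op[OF sa] \<open>0 \<le> r\<close>])
  fix x
  have "positive_op (poly_op ([:r:] - p) A)" "positive_op (poly_op ([:r:] + p) A)"
    using bound by (auto intro!: poly_op_positive sa simp: abs_le_iff) (smt (verit))
  then show "\<bar>Re (cinner (op_apply (poly_op p A) x) x)\<bar> \<le> r * (norm x)\<^sup>2"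
    using positive_opD[of "poly_op ([:r:] - p) A" x] positive_opD[of "poly_op ([:r:] + p) A" x]
    by (simp add: poly_op_add poly_op_diff poly_op_const op_apply_simps cinner_simps Re_cinner_self
        abs_le_iff)
qed

section \<open>Continuous functional calculus\<close>

text \<open>Makes the description in \<open>cfc\<close> definite: two approximating sequences differ
  by polynomials uniformly small on the spectrum, and \<open>norm_poly_op_le\<close> carries this
  over to the operators.\<close>

lemma cfc_unique:
  fixes A :: "'a::complex_hilbert bounded_op"
  assumes sa: "self_adjoint A"
    and p: "uniform_limit {t. complex_of_real t \<in> spectrum_op A} (\<lambda>n. poly (p n)) f sequentially"
    and B: "(\<lambda>n. poly_op (p n) A) \<longlonglongrightarrow> B"
  shows "cfc f A = B"
  unfolding cfc_def
proof (rule the_equality)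
  show "\<exists>p. uniform_limit {t. complex_of_real t \<in> spectrum_op A} (\<lambda>n. poly (p n)) f sequentially \<and>
     (\<lambda>n. poly_op (p n) A) \<longlonglongrightarrow> B"
    using p B by blast
next
  fix C
  assume "\<exists>p. uniform_limit {t. complex_of_real t \<in> spectrum_op A} (\<lambda>n. poly (p n)) f sequentially \<and>
     (\<lambda>n. poly_op (p n) A) \<longlonglongrightarrow> C"
  then obtain q
    where q: "uniform_limit {t. complex_of_real t \<in> spectrum_op A} (\<lambda>n. poly (q n)) f sequentially"
      and C: "(\<lambda>n. poly_op (q n) A) \<longlonglongrightarrow> C"
    by blast
  have "(\<lambda>n. poly_op (q n - p n) A) \<longlonglongrightarrow> 0"
    unfolding tendsto_iff
  proof (intro allI impI)
    fix e :: real assume "0 < e"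
    \<comment> \<open>Two errors below \<open>e / 4\<close> add up to the nonstrict norm bound
      \<open>e / 2\<close>, still strictly below \<open>e\<close>.\<close>
    then have "0 < e / 4" by simp
    from uniform_limitD[OF p this] uniform_limitD[OF q this]
    show "\<forall>\<^sub>F n in sequentially. dist (poly_op (q n - p n) A) 0 < e"
    proof eventually_elim
      case (elim n)
      have "norm (poly_op (q n - p n) A) \<le> e / 2"
      proof (rule norm_poly_op_le[OF sa])
        fix t assume "complex_of_real t \<in> spectrum_op A"
        with elim have "dist (poly (p n) t) (f t) < e / 4" "dist (poly (q n) t) (f t) < e / 4"
          by auto
        then show "\<bar>poly (q n - p n) t\<bar> \<le> e / 2"
          unfolding dist_real_def poly_diff by linarith
      qed (use \<open>0 < e\<close> in simp)
      with \<open>0 < e\<close> show ?case by simp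
    qed
  qed
  moreover have "(\<lambda>n. poly_op (q n - p n) A) \<longlonglongrightarrow> C - B"
    unfolding poly_op_diff by (intro tendsto_diff B C)
  ultimately have "C - B = 0"
    using LIMSEQ_unique by blast
  then show "C = B" by simp
qed

lemma cfc_poly: "self_adjoint A \<Longrightarrow> cfc (poly p) A = poly_op p (A :: 'a::complex_hilbert bounded_op)"
  by (rule cfc_unique[where p = "\<lambda>_. p"]) (auto intro: uniform_limit_const)

text \<open>Existence for the functional calculus: Weierstrass supplies the polynomials, the norm
  bound makes their operator values Cauchy, and completeness gives the limit.\<close>

lemma cfc_approx:
  fixes A :: "'a::complex_hilbert bounded_op"
  assumes sa: "self_adjoint A"
    and spec: "{t. complex_of_real t \<in> spectrum_op A} \<subseteq> {a..b}"
    and cont: "continuous_on {a..b} f"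
  obtains p where
    "uniform_limit {t. complex_of_real t \<in> spectrum_op A} (\<lambda>n. poly (p n)) f sequentially"
    "(\<lambda>n. poly_op (p n) A) \<longlonglongrightarrow> cfc f A"
proof -
  have "\<exists>p. \<forall>t\<in>{a..b}. \<bar>f t - poly p t\<bar> < inverse (Suc n)" for n
  proof -
    obtain g where g: "real_polynomial_function g"
      "\<And>t. t \<in> {a..b} \<Longrightarrow> \<bar>f t - g t\<bar> < inverse (Suc n)"
      by (rule Stone_Weierstrass_real_polynomial_function[of "{a..b}" f "inverse (Suc n)"])
        (use cont in auto)
    obtain c k where "g = (\<lambda>x. \<Sum>i\<le>k. c i * x ^ i)"
      using g(1) by (auto simp: real_polynomial_function_iff_sum)
    then have "g = poly (\<Sum>i\<le>k. monom (c i) i)"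
      by (simp add: fun_eq_iff poly_sum poly_monom)
    with g(2) show ?thesis by blast
  qed
  then obtain p where p: "\<And>n t. t \<in> {a..b} \<Longrightarrow> \<bar>f t - poly (p n) t\<bar> < inverse (Suc n)"
    by metis
  have unif: "uniform_limit {t. complex_of_real t \<in> spectrum_op A} (\<lambda>n. poly (p n)) f sequentially"
  proof (rule uniform_limitI)
    fix e :: real assume "0 < e"
    then have "\<forall>\<^sub>F n in sequentially. inverse (real (Suc n)) < e"
      using LIMSEQ_inverse_real_of_nat order_tendstoD(2) by blast
    then show "\<forall>\<^sub>F n in sequentially.
        \<forall>t\<in>{t. complex_of_real t \<in> spectrum_op A}. dist (poly (p n) t) (f t) < e"
    proof eventually_elim
      case (elim n)
      show ?case
      proof
        fix t assume "t \<in> {t. complex_of_real t \<in> spectrum_op A}"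
        with spec have "\<bar>f t - poly (p n) t\<bar> < inverse (Suc n)"
          by (intro p) auto
        with elim show "dist (poly (p n) t) (f t) < e"
          by (simp add: dist_real_def abs_minus_commute)
      qed
    qed
  qed
  have "Cauchy (\<lambda>n. poly_op (p n) A)"
  proof (rule metric_CauchyI)
    fix e :: real assume "0 < e"
    then have "0 < e / 4" by simp
    from uniform_limitD[OF unif this]
    obtain N where N: "\<And>n t. n \<ge> N \<Longrightarrow> complex_of_real t \<in> spectrum_op A
        \<Longrightarrow> dist (poly (p n) t) (f t) < e / 4"
      unfolding eventually_sequentially by blast
    have "dist (poly_op (p i) A) (poly_op (p j) A) \<le> e / 2" if "i \<ge> N" "j \<ge> N" for i j
      unfolding dist_norm poly_op_diff[symmetric]
    proof (rule norm_poly_op_le[OF sa])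
      fix t assume "complex_of_real t \<in> spectrum_op A"
      with N that have "dist (poly (p i) t) (f t) < e / 4" "dist (poly (p j) t) (f t) < e / 4"
        by auto
      then show "\<bar>poly (p i - p j) t\<bar> \<le> e / 2"
        unfolding dist_real_def poly_diff by linarith
    qed (use \<open>0 < e\<close> in simp)
    moreover have "e / 2 < e"
      using \<open>0 < e\<close> by simp
    ultimately show "\<exists>N. \<forall>i\<ge>N. \<forall>j\<ge>N. dist (poly_op (p i) A) (poly_op (p j) A) < e"
      using le_less_trans by blast
  qed
  then obtain B where "(\<lambda>n. poly_op (p n) A) \<longlonglongrightarrow> B"
    by (auto simp: Cauchy_convergent_iff convergent_def)
  with cfc_unique[OF sa unif this] unif that show thesis by blast
qed

lemma self_adjoint_cfc:
  fixes A :: "'a::complex_hilbert bounded_op"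
  assumes "self_adjoint A" "{t. complex_of_real t \<in> spectrum_op A} \<subseteq> {a..b}"
    "continuous_on {a..b} f"
  shows "self_adjoint (cfc f A)"
  by (rule cfc_approx[OF assms]) (blast intro: self_adjoint_tendsto self_adjoint_poly_op assms)

text \<open>The approximants of \<open>f\<close> and \<open>g\<close> may violate the order
  slightly, so a constant \<open>d\<close> restores nonnegativity of the difference on the spectrum;
  its contribution to the form is then made arbitrarily small.\<close>

lemma cfc_mono:
  fixes A :: "'a::complex_hilbert bounded_op"
  assumes sa: "self_adjoint A"
    and spec: "{t. complex_of_real t \<in> spectrum_op A} \<subseteq> {a..b}"
    and cont: "continuous_on {a..b} f" "continuous_on {a..b} g"
    and le: "\<And>t. t \<in> {a..b} \<Longrightarrow> f t \<le> g t"
  shows "cfc f A \<preceq> cfc g A"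
proof -
  note saf = self_adjoint_cfc[OF sa spec cont(1)] and sag = self_adjoint_cfc[OF sa spec cont(2)]
  obtain p where
    p: "uniform_limit {t. complex_of_real t \<in> spectrum_op A} (\<lambda>n. poly (p n)) f sequentially"
    and P: "(\<lambda>n. poly_op (p n) A) \<longlonglongrightarrow> cfc f A"
    by (rule cfc_approx[OF sa spec cont(1)])
  obtain q where
    q: "uniform_limit {t. complex_of_real t \<in> spectrum_op A} (\<lambda>n. poly (q n)) g sequentially"
    and Q: "(\<lambda>n. poly_op (q n) A) \<longlonglongrightarrow> cfc g A"
    by (rule cfc_approx[OF sa spec cont(2)])
  have "0 \<le> Re (cinner (op_apply (cfc g A - cfc f A) x) x)" for x
  proof (rule field_le_epsilon)
    fix e :: real assume "0 < e"
    \<comment> \<open>Chosen to give \<open>d * (norm x)\<^sup>2 \<le> e\<close>; the added 1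
      handles \<open>x = 0\<close>.\<close>
    define d where "d = e / ((norm x)\<^sup>2 + 1)"
    have "0 < (norm x)\<^sup>2 + 1"
      by (rule add_nonneg_pos) simp_all
    then have "0 < d" using \<open>0 < e\<close> by (simp add: d_def)
    have "d * (norm x)\<^sup>2 \<le> e"
      using \<open>0 < e\<close> \<open>0 < (norm x)\<^sup>2 + 1\<close> unfolding d_def
      by (simp add: divide_le_eq distrib_left)
    have "0 < d / 2" using \<open>0 < d\<close> by simp
    from uniform_limitD[OF p this] uniform_limitD[OF q this]
    have "\<forall>\<^sub>F n in sequentially. 0 \<le> Re (cinner (op_apply (poly_op (q n - p n + [:d:]) A) x) x)"
    proof eventually_elim
      case (elim n)
      have "positive_op (poly_op (q n - p n + [:d:]) A)"
      proof (rule poly_op_positive[OF sa])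
        fix t assume t: "complex_of_real t \<in> spectrum_op A"
        with elim have "dist (poly (p n) t) (f t) < d / 2" "dist (poly (q n) t) (g t) < d / 2"
          by auto
        then have "poly (p n) t < f t + d / 2" "g t - d / 2 < poly (q n) t"
          unfolding dist_real_def by linarith+
        moreover have "f t \<le> g t"
          using t spec by (intro le) auto
        ultimately show "0 \<le> poly (q n - p n + [:d:]) t"
          by simp
      qed
      then show ?case by (rule positive_opD)
    qed
    moreover have "(\<lambda>n. Re (cinner (op_apply (poly_op (q n - p n + [:d:]) A) x) x))
        \<longlonglongrightarrow> Re (cinner (op_apply (cfc g A - cfc f A + d *\<^sub>R 1) x) x)"
      unfolding poly_op_add poly_op_diff poly_op_const
      by (intro tendsto_Re tendsto_cinner_op_apply tendsto_add tendsto_diff P Q tendsto_const)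
    ultimately have "0 \<le> Re (cinner (op_apply (cfc g A - cfc f A + d *\<^sub>R 1) x) x)"
      by (rule tendsto_lowerbound[OF _ _ sequentially_bot, rotated])
    then show "0 \<le> Re (cinner (op_apply (cfc g A - cfc f A) x) x) + e"
      using \<open>d * (norm x)\<^sup>2 \<le> e\<close> by (simp add: op_apply_simps cinner_simps Re_cinner_self)
  qed
  then show ?thesis
    using saf sag by (auto simp: loewner_le_def intro!: positive_opI self_adjoint_intros)
qed

text \<open>Multiplying approximants of \<open>inverse\<close> by the variable gives approximants of
  the constant 1, so uniqueness yields a right inverse. It commutes with \<open>A\<close>, being a
  limit of polynomials in \<open>A\<close>.\<close>

lemma cfc_inverse:
  fixes A :: "'a::complex_hilbert bounded_op"
  assumes sa: "self_adjoint A"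
    and spec: "{t. complex_of_real t \<in> spectrum_op A} \<subseteq> {a..b}" and "0 < a"
  shows "cfc inverse A = op_inverse A"
proof -
  have cont: "continuous_on {a..b} inverse"
    using \<open>0 < a\<close> by (intro continuous_intros) auto
  obtain p where
    p: "uniform_limit {t. complex_of_real t \<in> spectrum_op A} (\<lambda>n. poly (p n)) inverse sequentially"
    and P: "(\<lambda>n. poly_op (p n) A) \<longlonglongrightarrow> cfc inverse A"
    by (rule cfc_approx[OF sa spec cont])
  have "uniform_limit {t. complex_of_real t \<in> spectrum_op A} (\<lambda>n. poly (pCons 0 (p n))) (poly [:1:])
      sequentially"
  proof (rule uniform_limitI)
    fix e :: real assume "0 < e"
    \<comment> \<open>\<open>\<bar>b\<bar> + 1\<close> dominates every spectral \<open>t\<close> and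
      is positive whatever the sign of \<open>b\<close>.\<close>
    define d where "d = e / (\<bar>b\<bar> + 1)"
    have "0 < d" using \<open>0 < e\<close> by (simp add: d_def add_nonneg_pos)
    from uniform_limitD[OF p this]
    show "\<forall>\<^sub>F n in sequentially. \<forall>t\<in>{t. complex_of_real t \<in> spectrum_op A}.
        dist (poly (pCons 0 (p n)) t) (poly [:1:] t) < e"
    proof eventually_elim
      case (elim n)
      show ?case
      proof
        fix t assume t: "t \<in> {t. complex_of_real t \<in> spectrum_op A}"
        with spec \<open>0 < a\<close> have t': "0 < t" "t \<le> b" by auto
        have "dist (poly (pCons 0 (p n)) t) (poly [:1:] t) = t * dist (poly (p n) t) (inverse t)"
          using t' by (simp add: dist_real_def field_simps abs_mult)
        also have "\<dots> < t * d"
          using elim t t' by simp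
        also have "\<dots> \<le> (\<bar>b\<bar> + 1) * d"
          using t' \<open>0 < d\<close> by (intro mult_right_mono) auto
        also have "\<dots> = e"
          by (simp add: d_def)
        finally show "dist (poly (pCons 0 (p n)) t) (poly [:1:] t) < e" .
      qed
    qed
  qed
  moreover have lim: "(\<lambda>n. poly_op (pCons 0 (p n)) A) \<longlonglongrightarrow> A * cfc inverse A"
    by (simp add: poly_op_pCons) (intro tendsto_mult tendsto_const P)
  ultimately have "cfc (poly [:1:]) A = A * cfc inverse A"
    by (rule cfc_unique[OF sa])
  then have right: "A * cfc inverse A = 1"
    using cfc_poly[OF sa, of "[:1:]"] by (simp add: poly_op_const del: poly_pCons)
  have "(\<lambda>n. poly_op (p n) A * A) \<longlonglongrightarrow> cfc inverse A * A"
    by (intro tendsto_mult tendsto_const P)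
  then have "cfc inverse A * A = A * cfc inverse A"
    using lim LIMSEQ_unique by (auto simp: poly_op_pCons poly_op_commute)
  with right show ?thesis
    using op_inverse_eqI by metis
qed

section \<open>Positive maps\<close>

text \<open>\<open>A\<close> is a multiple of the identity minus the positive operator
  \<open>norm A *\<^sub>R 1 - A\<close>; the images of both are self-adjoint.\<close>

lemma positive_map_self_adjoint:
  assumes lin: "Vector_Spaces.linear scaleC scaleC \<Phi>"
    and pos: "positive_map \<Phi>" and norm: "normalized_map \<Phi>" and sa: "self_adjoint A"
  shows "self_adjoint (\<Phi> A)"
proof -
  interpret Vector_Spaces.linear scaleC scaleC \<Phi> by (rule lin)
  have "self_adjoint (\<Phi> (norm A *\<^sub>R 1 - A))"
    using pos positive_norm_scaleR_one_diff(1)[OF sa] positive_imp_self_adjoint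
    by (auto simp: positive_map_def)
  then have "self_adjoint (norm A *\<^sub>R 1 - \<Phi> A)"
    using norm by (simp add: diff scale scaleR_scaleC normalized_map_def)
  then have "self_adjoint (norm A *\<^sub>R 1 - (norm A *\<^sub>R 1 - \<Phi> A))"
    by (rule self_adjoint_diff[OF self_adjoint_scaleR[OF self_adjoint_one]])
  then show ?thesis by simp
qed

lemma positive_map_mono:
  assumes lin: "Vector_Spaces.linear scaleC scaleC \<Phi>"
    and pos: "positive_map \<Phi>" and norm: "normalized_map \<Phi>" and "A \<preceq> B"
  shows "\<Phi> A \<preceq> \<Phi> B"
proof -
  interpret Vector_Spaces.linear scaleC scaleC \<Phi> by (rule lin)
  show ?thesis
    using positive_map_self_adjoint[OF lin pos norm] pos \<open>A \<preceq> B\<close>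
    by (auto simp: loewner_le_def positive_map_def simp flip: diff)
qed

lemma loewner_trans [trans]: "A \<preceq> B \<Longrightarrow> B \<preceq> C \<Longrightarrow> A \<preceq> C"
  using positive_op_add[of "B - A" "C - B"] by (simp add: loewner_le_def)

text \<open>The difference of the two sides is \<open>(s / 2 - B) B\<^sup>-\<^sup>1 (s / 2 - B)\<close>.\<close>

lemma linear_le_op_inverse:
  fixes B :: "'a::complex_hilbert bounded_op"
  assumes "0 < a" and lower: "a *\<^sub>R 1 \<preceq> B"
  shows "s *\<^sub>R 1 - B \<preceq> (s\<^sup>2 / 4) *\<^sub>R op_inverse B"
proof -
  have sa: "self_adjoint B"
    using lower by (simp add: loewner_le_def)
  define R where "R = op_inverse B"
  have "op_invertible B"
    using \<open>0 < a\<close> loewner_lower_bound[OF lower] by (rule coercive_invertible)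
  then have BR: "B * R = 1" "R * B = 1"
    by (simp_all add: R_def op_inverse_times)
  have BRx: "op_apply B (op_apply R x) = x" and RBx: "op_apply R (op_apply B x) = x" for x
    by (metis BR op_apply_simps(5,6))+
  have saR: "self_adjoint R"
    unfolding self_adjoint_def by (metis BRx sa self_adjointD)
  \<comment> \<open>The form of \<open>R\<close> at \<open>x\<close> is the form of \<open>B\<close>
    at \<open>op_apply R x\<close>.\<close>
  have posR: "0 \<le> Re (cinner (op_apply R x) x)" for x
  proof -
    have "0 \<le> a * (norm (op_apply R x))\<^sup>2" using \<open>0 < a\<close> by simp
    also have "\<dots> \<le> Re (cinner x (op_apply R x))"
      using loewner_lower_bound[OF lower, of "op_apply R x"] by (simp add: BRx)
    finally show ?thesis by (simp add: Re_cinner_commute)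
  qed
  have "0 \<le> Re (cinner (op_apply ((s\<^sup>2 / 4) *\<^sub>R R - (s *\<^sub>R 1 - B)) x) x)" for x
  proof -
    have "cinner (op_apply R x) (op_apply B x) = cinner x x"
      by (metis BRx sa self_adjointD)
    then have "Re (cinner (op_apply ((s\<^sup>2 / 4) *\<^sub>R R - (s *\<^sub>R 1 - B)) x) x)
        = Re (cinner (op_apply R ((s / 2) *\<^sub>R x - op_apply B x)) ((s / 2) *\<^sub>R x - op_apply B x))"
      using Re_cinner_commute[of x "op_apply B x"]
      by (simp add: op_apply_simps op_apply_arg_simps cinner_simps RBx power2_eq_square
          algebra_simps)
    also have "\<dots> \<ge> 0" by (rule posR)
    finally show ?thesis .
  qed
  then have "positive_op ((s\<^sup>2 / 4) *\<^sub>R R - (s *\<^sub>R 1 - B))"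
    using sa saR by (intro positive_opI self_adjoint_intros)
  then show ?thesis
    using sa saR by (simp add: loewner_le_def R_def self_adjoint_intros)
qed

lemma loewner_scaleR:
  "0 \<le> c \<Longrightarrow> A \<preceq> B \<Longrightarrow> c *\<^sub>R A \<preceq> c *\<^sub>R B"
  by (auto simp: loewner_le_def self_adjoint_scaleR positive_op_iff op_apply_simps cinner_simps
      simp flip: right_diff_distrib)

section \<open>Interpolating the reciprocal\<close>

lemma geometric_interpolation_bounds:
  fixes m M t :: real
  assumes "0 < m" and "m < M" and t: "m \<le> t" "t \<le> M"
  defines "g \<equiv> m powr ((t - M) / (M - m)) * M powr ((m - t) / (M - m))"
  shows "inverse t \<le> g" and "g \<le> (M + m - t) / (M * m)"
proof -
  \<comment> \<open>\<open>u\<close> is the weight of \<open>m\<close> when \<open>t\<close> is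
    written as a convex combination of \<open>m\<close> and \<open>M\<close>; the exponents in
    \<open>g\<close> become \<open>- u\<close> and \<open>- (1 - u)\<close>.\<close>
  define u where "u = (M - t) / (M - m)"
  have u: "0 \<le> u" "u \<le> 1"
    using assms by (auto simp: u_def)
  have e1: "(t - M) / (M - m) = - u" and e2: "(m - t) / (M - m) = - (1 - u)"
    using assms(2) by (simp_all add: u_def field_simps)
  have "u * (M - m) = M - t"
    using assms(2) by (simp add: u_def)
  then have tu: "t = u * m + (1 - u) * M"
    by (simp add: algebra_simps)
  have pos: "0 < M" "0 < t" using assms by auto
  have g: "g = exp (u * ln (inverse m) + (1 - u) * ln (inverse M))"
    unfolding g_def e1 e2 using assms pos
    by (simp add: powr_def ln_inverse algebra_simps flip: exp_add)
  have "u * ln m + (1 - u) * ln M \<le> ln t"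
    \<comment> \<open>The parameter of \<open>concave_onD\<close> weights the second point, hence
      \<open>1 - u\<close>.\<close>
    using concave_onD[OF ln_concave, of "1 - u" m M] u pos assms(1) tu by simp
  then have "exp (- ln t) \<le> g"
    unfolding g using pos assms(1) by (simp add: ln_inverse algebra_simps)
  then show "inverse t \<le> g"
    using pos by (simp add: exp_minus)
  \<comment> \<open>The weighted arithmetic-geometric mean inequality for \<open>inverse m\<close>
    and \<open>inverse M\<close>, read as convexity of \<open>exp\<close>.\<close>
  have "g \<le> u * exp (ln (inverse m)) + (1 - u) * exp (ln (inverse M))"
    unfolding g using convex_onD[OF exp_convex, of "1 - u" "ln (inverse m)" "ln (inverse M)"] u
    by simp
  also have "\<dots> = (M + m - t) / (M * m)"
    using pos assms(1) unfolding tu by (simp add: field_simps)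
  finally show "g \<le> (M + m - t) / (M * m)" .
qed

theorem theorem1p1:
  fixes A :: "'h::complex_hilbert bounded_op"
    and \<Phi> :: "'h bounded_op \<Rightarrow> 'k::complex_hilbert bounded_op"
    and m M :: real
  assumes "positive_op A"
    and "0 < m" and "m < M"
    and "m *\<^sub>R 1 \<preceq> A" and "A \<preceq> M *\<^sub>R 1"
    and "Vector_Spaces.linear scaleC scaleC \<Phi>"
    and "positive_map \<Phi>" and "normalized_map \<Phi>"
  shows "\<Phi> (op_inverse A)
           \<preceq> \<Phi> (cfc (\<lambda>t. m powr ((t - M) / (M - m)) * M powr ((m - t) / (M - m))) A)
       \<and> \<Phi> (cfc (\<lambda>t. m powr ((t - M) / (M - m)) * M powr ((m - t) / (M - m))) A)
           \<preceq> ((M + m)\<^sup>2 / (4 * M * m)) *\<^sub>R op_inverse (\<Phi> A)"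
proof -
  let ?g = "\<lambda>t. m powr ((t - M) / (M - m)) * M powr ((m - t) / (M - m))"
  interpret Vector_Spaces.linear scaleC scaleC \<Phi> by (rule assms(6))
  have scaleR: "\<Phi> (r *\<^sub>R X) = r *\<^sub>R \<Phi> X" for r X
    by (simp add: scale scaleR_scaleC)
  have one: "\<Phi> 1 = 1"
    using assms(8) by (simp add: normalized_map_def)
  note mono = positive_map_mono[OF assms(6-8)]
  have sa: "self_adjoint A"
    using assms(4) by (simp add: loewner_le_def)
  note spec = spectrum_subset_interval[OF assms(4,5)]
  \<comment> \<open>The chord of the reciprocal through its values at \<open>m\<close> and
    \<open>M\<close>.\<close>
  define l where "l = [:(M + m) / (M * m), - (1 / (M * m)):]"
  have cont: "continuous_on {m..M} inverse" "continuous_on {m..M} ?g" "continuous_on {m..M} (poly l)"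
    using assms(2,3) by (auto intro!: continuous_intros)
  have "op_inverse A \<preceq> cfc ?g A"
    unfolding cfc_inverse[OF sa spec assms(2), symmetric]
    by (rule cfc_mono[OF sa spec cont(1,2)])
      (use geometric_interpolation_bounds(1)[OF assms(2,3)] in auto)
  then have part1: "\<Phi> (op_inverse A) \<preceq> \<Phi> (cfc ?g A)"
    by (rule mono)
  have "poly l t = (M + m - t) / (M * m)" for t
    by (simp add: l_def diff_divide_distrib)
  then have "cfc ?g A \<preceq> cfc (poly l) A"
    using geometric_interpolation_bounds(2)[OF assms(2,3)]
    by (intro cfc_mono[OF sa spec cont(2,3)]) simp
  then have "\<Phi> (cfc ?g A) \<preceq> \<Phi> (poly_op l A)"
    unfolding cfc_poly[OF sa] by (rule mono)
  also have "\<Phi> (poly_op l A) = (1 / (M * m)) *\<^sub>R ((M + m) *\<^sub>R 1 - \<Phi> A)"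
    by (simp add: l_def poly_op_pCons add diff scaleR one scaleR_diff_right)
  also have "(1 / (M * m)) *\<^sub>R ((M + m) *\<^sub>R 1 - \<Phi> A)
      \<preceq> (1 / (M * m)) *\<^sub>R (((M + m)\<^sup>2 / 4) *\<^sub>R op_inverse (\<Phi> A))"
  \<comment> \<open>Completing the square is applied to \<open>\<Phi> A\<close> with
    \<open>s = M + m\<close>; the lower bound \<open>m\<close> passes from \<open>A\<close> to
    \<open>\<Phi> A\<close> by normalization and makes \<open>\<Phi> A\<close> invertible.\<close>
  proof (intro loewner_scaleR linear_le_op_inverse[OF assms(2)])
    show "m *\<^sub>R 1 \<preceq> \<Phi> A"
      using mono[OF assms(4)] by (simp add: scaleR one)
  qed (use assms(2,3) in simp)
  also have "(1 / (M * m)) *\<^sub>R (((M + m)\<^sup>2 / 4) *\<^sub>R op_inverse (\<Phi> A))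
      = ((M + m)\<^sup>2 / (4 * M * m)) *\<^sub>R op_inverse (\<Phi> A)"
    by simp
  finally have "\<Phi> (cfc ?g A) \<preceq> ((M + m)\<^sup>2 / (4 * M * m)) *\<^sub>R op_inverse (\<Phi> A)" .
  with part1 show ?thesis by blast
qed

end
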